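(* There are no Lorentz meridian surfaces $$\mathcal{M}_m:\ z(u,v) = f(u)\left(\varphi(v)\cosh v\, e_1 + \varphi(v)\sinh v\, e_3 + \frac{\varphi^2(v)}{2}\,\xi_1 + \xi_2\right) + g(u)\,\xi_1,\quad u\in I,\ v\in J,$$ in $\mathbb{E}^4_2$ with non-zero parallel mean curvature vector field ($H\neq0$ and $DH=0$) other than CMC surfaces lying in a hyperplane of $\mathbb{E}^4_2$. That is, every such surface with $H\neq 0$ and $DH=0$ is a CMC surface lying in a hyperplane of $\mathbb{E}^4_2$.
   Context: $\mathbb{E}^4_2$ is $\mathbb{R}^4$ with the metric $\langle\cdot,\cdot\rangle$ given by $dx_1^2+dx_2^2-dx_3^2-dx_4^2$, and $e_1,e_2,e_3,e_4$ is a fixed orthonormal basis with $\langle e_1,e_1\rangle=\langle e_2,e_2\rangle=1$, $\langle e_3,e_3\rangle=\langle e_4,e_4\rangle=-1$. Put $\xi_1=\frac{e_2+e_4}{\sqrt2}$, $\xi_2=\frac{-e_2+e_4}{\sqrt2}$, so that $\langle\xi_1,\xi_1\rangle=\langle\xi_2,\xi_2\rangle=0$, $\langle\xi_1,\xi_2\rangle=-1$. Let $I,J\subset\mathbb{R}$ be open intervals, $f,g:I\to\mathbb{R}$ and $\varphi:J\to\mathbb{R}$ smooth with $f>0$. Primes denote derivatives with respect to $u$ and dots denote derivatives of $\varphi$ with respect to $v$. The surface $\mathcal{M}_m$ given by $z(u,v)$ is called a meridian surface; its first fundamental form has coefficients $E=-2f'g'$, $F=0$, $G=f^2(\dot\varphi^2-\varphi^2)$.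 Only Lorentz surfaces (induced metric of signature $(1,1)$) are considered, so it is assumed that either $\dot\varphi^2-\varphi^2>0$ on $J$ and $f'g'>0$ on $I$, or $\dot\varphi^2-\varphi^2<0$ on $J$ and $f'g'<0$ on $I$. The mean curvature vector field is $H=\frac12\,\mathrm{tr}\,h$, where $h$ is the second fundamental form and the trace is taken with respect to the induced metric. The normal connection $D$ is given by $D_X\xi=$ the normal part of $\overline\nabla_X\xi$ for tangent $X$ and normal $\xi$, where $\overline\nabla$ is the flat connection of $\mathbb{E}^4_2$. $H$ is parallel if $DH=0$ identically. A CMC surface is one with $\langle H,H\rangle=\mathrm{const}\neq0$. A hyperplane is a 3-dimensional affine subspace. *)

theory Defs
  imports "HOL-Analysis.Analysis"
begin

section \<open>The pseudo-Euclidean space of dimension 4 and index 2\<close>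

definition pseudo_inner :: "real^4 \<Rightarrow> real^4 \<Rightarrow> real"  (\<open>\<llangle>_, _\<rrangle>\<close>)
  where "\<llangle>x, y\<rrangle> = x$1 * y$1 + x$2 * y$2 - x$3 * y$3 - x$4 * y$4"

text \<open>Four such vectors are automatically linearly independent, hence a basis.\<close>

definition pseudo_orthonormal_basis :: "(4 \<Rightarrow> real^4) \<Rightarrow> bool"
  where "pseudo_orthonormal_basis e \<longleftrightarrow>
    (\<forall>i j. \<llangle>e i, e j\<rrangle> = (if i = j then (if i = 1 \<or> i = 2 then 1 else -1) else 0))"

definition hyperplane :: "(real^4) set \<Rightarrow> bool"
  where "hyperplane P \<longleftrightarrow> affine P \<and> aff_dim P = 3"


section \<open>Smooth functions on open subsets of the line\<close>

definition smooth_on :: "real set \<Rightarrow> (real \<Rightarrow> real) \<Rightarrow> bool"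
  where "smooth_on S f \<longleftrightarrow> (\<forall>n. \<forall>x\<in>S. (deriv ^^ n) f differentiable (at x))"


section \<open>Parametrized surfaces\<close>

definition D1 :: "(real \<Rightarrow> real \<Rightarrow> real^4) \<Rightarrow> real \<Rightarrow> real \<Rightarrow> real^4"
  where "D1 z u v = vector_derivative (\<lambda>s. z s v) (at u)"

definition D2 :: "(real \<Rightarrow> real \<Rightarrow> real^4) \<Rightarrow> real \<Rightarrow> real \<Rightarrow> real^4"
  where "D2 z u v = vector_derivative (\<lambda>t. z u t) (at v)"

definition tangent_plane :: "(real \<Rightarrow> real \<Rightarrow> real^4) \<Rightarrow> real \<Rightarrow> real \<Rightarrow> (real^4) set"
  where "tangent_plane z u v = span {D1 z u v, D2 z u v}"

definition fff_E :: "(real \<Rightarrow> real \<Rightarrow> real^4) \<Rightarrow> real \<Rightarrow> real \<Rightarrow> real"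
  where "fff_E z u v = \<llangle>D1 z u v, D1 z u v\<rrangle>"

definition fff_F :: "(real \<Rightarrow> real \<Rightarrow> real^4) \<Rightarrow> real \<Rightarrow> real \<Rightarrow> real"
  where "fff_F z u v = \<llangle>D1 z u v, D2 z u v\<rrangle>"

definition fff_G :: "(real \<Rightarrow> real \<Rightarrow> real^4) \<Rightarrow> real \<Rightarrow> real \<Rightarrow> real"
  where "fff_G z u v = \<llangle>D2 z u v, D2 z u v\<rrangle>"

text \<open>The component of \<open>w\<close> orthogonal to the tangent plane.  It exists and is unique exactly where
  the induced metric is nondegenerate and the parametrization is regular, in particular on
  Lorentz surfaces; elsewhere the value is unspecified.\<close>

definition normal_part :: "(real \<Rightarrow> real \<Rightarrow> real^4) \<Rightarrow> real \<Rightarrow> real \<Rightarrow> real^4 \<Rightarrow> real^4"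
  where "normal_part z u v w =
    (THE n. (\<forall>t\<in>tangent_plane z u v. \<llangle>n, t\<rrangle> = 0) \<and> w - n \<in> tangent_plane z u v)"

text \<open>Values of the second fundamental form on pairs of coordinate vectors (Gauss formula).\<close>

definition h11 :: "(real \<Rightarrow> real \<Rightarrow> real^4) \<Rightarrow> real \<Rightarrow> real \<Rightarrow> real^4"
  where "h11 z u v = normal_part z u v (D1 (D1 z) u v)"

definition h12 :: "(real \<Rightarrow> real \<Rightarrow> real^4) \<Rightarrow> real \<Rightarrow> real \<Rightarrow> real^4"
  where "h12 z u v = normal_part z u v (D1 (D2 z) u v)"

definition h22 :: "(real \<Rightarrow> real \<Rightarrow> real^4) \<Rightarrow> real \<Rightarrow> real \<Rightarrow> real^4"
  where "h22 z u v = normal_part z u v (D2 (D2 z) u v)"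

text \<open>Half of the metric trace \<open>g\<^sup>i\<^sup>j h\<^sub>i\<^sub>j\<close>, where \<open>g\<^sup>i\<^sup>j\<close> is the inverse of the matrix
  with rows \<open>(E, F)\<close> and \<open>(F, G)\<close>.\<close>

definition mean_curvature :: "(real \<Rightarrow> real \<Rightarrow> real^4) \<Rightarrow> real \<Rightarrow> real \<Rightarrow> real^4"
  where "mean_curvature z u v =
    (1 / 2) *\<^sub>R ((1 / (fff_E z u v * fff_G z u v - (fff_F z u v)\<^sup>2)) *\<^sub>R
      (fff_G z u v *\<^sub>R h11 z u v - (2 * fff_F z u v) *\<^sub>R h12 z u v + fff_E z u v *\<^sub>R h22 z u v))"

text \<open>The normal connection applied to a normal field \<open>\<xi>\<close>, in the direction of the tangent vector
  \<open>a z\<^sub>u + b z\<^sub>v\<close>; the flat connection along the surface is the directional derivative.\<close>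

definition normal_connection ::
    "(real \<Rightarrow> real \<Rightarrow> real^4) \<Rightarrow> real \<Rightarrow> real \<Rightarrow> (real \<Rightarrow> real \<Rightarrow> real^4) \<Rightarrow> real \<Rightarrow> real \<Rightarrow> real^4"
  where "normal_connection z a b \<xi> u v = normal_part z u v (a *\<^sub>R D1 \<xi> u v + b *\<^sub>R D2 \<xi> u v)"

definition parallel_on ::
    "real set \<Rightarrow> real set \<Rightarrow> (real \<Rightarrow> real \<Rightarrow> real^4) \<Rightarrow> (real \<Rightarrow> real \<Rightarrow> real^4) \<Rightarrow> bool"
  where "parallel_on I J z \<xi> \<longleftrightarrow> (\<forall>u\<in>I. \<forall>v\<in>J. \<forall>a b. normal_connection z a b \<xi> u v = 0)"

definition CMC_surface :: "real set \<Rightarrow> real set \<Rightarrow> (real \<Rightarrow> real \<Rightarrow> real^4) \<Rightarrow> bool"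
  where "CMC_surface I J z \<longleftrightarrow>
    (\<exists>c. c \<noteq> 0 \<and> (\<forall>u\<in>I. \<forall>v\<in>J. \<llangle>mean_curvature z u v, mean_curvature z u v\<rrangle> = c))"


section \<open>Meridian surfaces\<close>

definition \<xi>\<^sub>1 :: "(4 \<Rightarrow> real^4) \<Rightarrow> real^4"
  where "\<xi>\<^sub>1 e = (1 / sqrt 2) *\<^sub>R (e 2 + e 4)"

definition \<xi>\<^sub>2 :: "(4 \<Rightarrow> real^4) \<Rightarrow> real^4"
  where "\<xi>\<^sub>2 e = (1 / sqrt 2) *\<^sub>R (- e 2 + e 4)"

definition meridian_surface ::
    "(4 \<Rightarrow> real^4) \<Rightarrow> (real \<Rightarrow> real) \<Rightarrow> (real \<Rightarrow> real) \<Rightarrow> (real \<Rightarrow> real) \<Rightarrow> real \<Rightarrow> real \<Rightarrow> real^4"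
  where "meridian_surface e f g \<phi> u v =
    f u *\<^sub>R ((\<phi> v * cosh v) *\<^sub>R e 1 + (\<phi> v * sinh v) *\<^sub>R e 3 + ((\<phi> v)\<^sup>2 / 2) *\<^sub>R \<xi>\<^sub>1 e + \<xi>\<^sub>2 e)
      + g u *\<^sub>R \<xi>\<^sub>1 e"

end

theory Submission
  imports Defs
begin

text \<open>
  Write the surface as \<open>z = f l + g \<xi>\<^sub>1\<close>, where the curve
  \<open>l = \<phi> cosh v e\<^sub>1 + \<phi> sinh v e\<^sub>3 + (\<phi>\<^sup>2 / 2) \<xi>\<^sub>1 + \<xi>\<^sub>2\<close> lies in the light cone and
  \<open>\<langle>l, \<xi>\<^sub>1\<rangle> = -1\<close>.  The normal plane is spanned by the orthogonal fields \<open>n\<^sub>1 = f' l - g' \<xi>\<^sub>1\<close> and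
  \<open>n\<^sub>2\<close>, where \<open>n\<^sub>2\<close> depends on \<open>v\<close> only and is orthogonal to \<open>l\<close>, \<open>l'\<close> and \<open>\<xi>\<^sub>1\<close>.  Computing the
  second fundamental form gives \<open>H = \<alpha>(u) n\<^sub>1 + \<beta>(u, v) n\<^sub>2\<close> with
  \<open>\<beta> = - \<kappa>(v) / (2 f(u) \<langle>l', l'\<rangle>\<^sup>2)\<close> and \<open>\<kappa> = \<langle>l'', n\<^sub>2\<rangle>\<close> (\<open>mean_curvature_z\<close>).

  The whole argument rests on the derivative of \<open>H\<close> in the direction of \<open>u\<close>.  Since \<open>n\<^sub>2\<close> is constant
  in this direction, the \<open>n\<^sub>2\<close>-component of \<open>DH = 0\<close> reads \<open>\<beta>\<^sub>u = 0\<close>, that is \<open>\<kappa> f' = 0\<close>.  The Lorentz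
  condition excludes \<open>f' = 0\<close>, so \<open>\<kappa>\<close> vanishes (\<open>parallel_imp_\<kappa>_eq_0\<close>).  This has two consequences.
  First, \<open>H = \<alpha> n\<^sub>1\<close>, and the \<open>n\<^sub>1\<close>-component of \<open>DH = 0\<close> says that \<open>\<langle>H, H\<rangle> = 2 \<alpha>\<^sup>2 f' g'\<close> is constant;
  it is not zero because \<open>H\<close> is not and \<open>n\<^sub>1\<close> is not null (\<open>parallel_imp_CMC\<close>).  Second, the plane curve
  \<open>\<phi> cosh v e\<^sub>1 + \<phi> sinh v e\<^sub>3\<close> is straight, so \<open>n\<^sub>2\<close> has a constant direction, and the surface lies in
  the hyperplane through the origin that is orthogonal to it (\<open>\<kappa>_eq_0_imp_hyperplane\<close>).
\<close>

section \<open>The pseudo-Euclidean inner product and the frame of a meridian surface\<close>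

lemma pseudo_inner_add_left: "\<llangle>x + y, w\<rrangle> = \<llangle>x, w\<rrangle> + \<llangle>y, w\<rrangle>"
  and pseudo_inner_add_right: "\<llangle>w, x + y\<rrangle> = \<llangle>w, x\<rrangle> + \<llangle>w, y\<rrangle>"
  and pseudo_inner_diff_left: "\<llangle>x - y, w\<rrangle> = \<llangle>x, w\<rrangle> - \<llangle>y, w\<rrangle>"
  and pseudo_inner_diff_right: "\<llangle>w, x - y\<rrangle> = \<llangle>w, x\<rrangle> - \<llangle>w, y\<rrangle>"
  and pseudo_inner_scaleR_left: "\<llangle>c *\<^sub>R x, w\<rrangle> = c * \<llangle>x, w\<rrangle>"
  and pseudo_inner_scaleR_right: "\<llangle>w, c *\<^sub>R x\<rrangle> = c * \<llangle>w, x\<rrangle>"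
  and pseudo_inner_minus_left: "\<llangle>- x, w\<rrangle> = - \<llangle>x, w\<rrangle>"
  by (simp_all add: pseudo_inner_def algebra_simps)

lemmas pseudo_inner_linear = pseudo_inner_add_left pseudo_inner_add_right
  pseudo_inner_diff_left pseudo_inner_diff_right
  pseudo_inner_scaleR_left pseudo_inner_scaleR_right pseudo_inner_minus_left

lemma pseudo_inner_commute: "\<llangle>x, y\<rrangle> = \<llangle>y, x\<rrangle>"
  by (simp add: pseudo_inner_def algebra_simps)

text \<open>The vector \<open>w\<close> witnesses that the functional \<open>x \<mapsto> \<langle>x, n\<rangle>\<close> is not zero.\<close>

lemma hyperplane_pseudo_orthogonal:
  assumes "\<llangle>w, n\<rrangle> \<noteq> 0"
  shows "hyperplane {x. \<llangle>x, n\<rrangle> = 0}"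
proof -
  define n' :: "real^4" where "n' = (\<chi> i. if i = 1 \<or> i = 2 then n$i else - n$i)"
  have eq: "\<llangle>x, n\<rrangle> = n' \<bullet> x" for x
    by (simp add: pseudo_inner_def n'_def inner_vec_def sum_4 algebra_simps)
  have "n' \<noteq> 0"
    using assms eq by auto
  then show ?thesis
    unfolding hyperplane_def eq by (simp add: affine_hyperplane aff_dim_hyperplane)
qed

text \<open>The surface is written in the basis \<open>e\<^sub>1, e\<^sub>3, \<xi>\<^sub>1, \<xi>\<^sub>2\<close>.  In these coordinates every vector
  identity below becomes four scalar identities, and the metric has the simple form of
  \<open>pseudo_inner_frame_vector\<close>.\<close>

definition frame_vector :: "(4 \<Rightarrow> real^4) \<Rightarrow> real \<Rightarrow> real \<Rightarrow> real \<Rightarrow> real \<Rightarrow> real^4"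
  where "frame_vector e a b c d = a *\<^sub>R e 1 + b *\<^sub>R e 3 + c *\<^sub>R \<xi>\<^sub>1 e + d *\<^sub>R \<xi>\<^sub>2 e"

lemma frame_vector_add:
    "frame_vector e a b c d + frame_vector e a' b' c' d' = frame_vector e (a + a') (b + b') (c + c') (d + d')"
  and frame_vector_scaleR:
    "r *\<^sub>R frame_vector e a b c d = frame_vector e (r * a) (r * b) (r * c) (r * d)"
  by (simp_all add: frame_vector_def algebra_simps)

lemma pseudo_inner_frame_vector:
  assumes "pseudo_orthonormal_basis e"
  shows "\<llangle>frame_vector e a b c d, frame_vector e a' b' c' d'\<rrangle> = a * a' - b * b' - c * d' - d * c'"
proof -
  have e: "\<llangle>e i, e j\<rrangle> = (if i = j then (if i = 1 \<or> i = 2 then 1 else -1) else 0)" for i j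
    using assms unfolding pseudo_orthonormal_basis_def by blast
  show ?thesis
    unfolding frame_vector_def \<xi>\<^sub>1_def \<xi>\<^sub>2_def
    by (simp add: pseudo_inner_linear e field_simps)
qed

lemma frame_vector_has_vector_derivative:
  assumes "(a has_real_derivative a') (at t)" "(b has_real_derivative b') (at t)"
    "(c has_real_derivative c') (at t)" "(d has_real_derivative d') (at t)"
  shows "((\<lambda>t. frame_vector e (a t) (b t) (c t) (d t)) has_vector_derivative
      frame_vector e a' b' c' d') (at t)"
  unfolding frame_vector_def
  by (rule derivative_eq_intros assms refl | simp)+

section \<open>Partial derivatives\<close>

lemma D1_eqI:
  assumes "open I" "u \<in> I" "\<And>s. s \<in> I \<Longrightarrow> z s v = y s" "(y has_vector_derivative y') (at u)"
  shows "D1 z u v = y'"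
  unfolding D1_def
  by (rule vector_derivative_at, rule has_vector_derivative_transform_within_open[OF assms(4,1,2)])
    (simp add: assms(3))

lemma D2_eqI:
  assumes "open J" "v \<in> J" "\<And>t. t \<in> J \<Longrightarrow> z u t = y t" "(y has_vector_derivative y') (at v)"
  shows "D2 z u v = y'"
  unfolding D2_def
  by (rule vector_derivative_at, rule has_vector_derivative_transform_within_open[OF assms(4,1,2)])
    (simp add: assms(3))

lemma smooth_on_has_derivs:
  assumes "smooth_on S f" "x \<in> S"
  shows "(f has_real_derivative deriv f x) (at x)"
    and "(deriv f has_real_derivative deriv (deriv f) x) (at x)"
    and "(deriv (deriv f) has_real_derivative deriv (deriv (deriv f)) x) (at x)"
proof -
  have d: "((deriv ^^ n) f has_real_derivative (deriv ^^ Suc n) f x) (at x)" for n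
    using assms unfolding smooth_on_def
    by (simp add: DERIV_deriv_iff_real_differentiable)
  show "(f has_real_derivative deriv f x) (at x)"
    "(deriv f has_real_derivative deriv (deriv f) x) (at x)"
    "(deriv (deriv f) has_real_derivative deriv (deriv (deriv f)) x) (at x)"
    using d[of 0] d[of 1] d[of 2] by (simp_all add: numeral_2_eq_2)
qed

section \<open>Normal parts with respect to an orthogonal tangent frame\<close>

text \<open>Normal parts are computed by exhibiting a decomposition.  It is unique because coordinate vectors
  that are orthogonal and not null span a nondegenerate plane.\<close>

lemma normal_part_eqI:
  assumes F: "fff_F z u v = 0" and E: "fff_E z u v \<noteq> 0" and G: "fff_G z u v \<noteq> 0"
    and n: "\<llangle>n, D1 z u v\<rrangle> = 0" "\<llangle>n, D2 z u v\<rrangle> = 0"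
    and w: "w = n + p *\<^sub>R D1 z u v + q *\<^sub>R D2 z u v"
  shows "normal_part z u v w = n"
proof -
  have wn: "w - n \<in> tangent_plane z u v"
    unfolding w tangent_plane_def by (auto intro!: span_add span_scale intro: span_base)
  show ?thesis
    unfolding normal_part_def
  proof (rule the_equality)
    let ?T = "tangent_plane z u v"
    have "\<forall>t\<in>?T. \<exists>r s. t = r *\<^sub>R D1 z u v + s *\<^sub>R D2 z u v"
      by (auto simp: tangent_plane_def span_insert span_singleton eq_diff_eq algebra_simps)
    then have "\<forall>t\<in>?T. \<llangle>n, t\<rrangle> = 0"
      using n by (auto simp: pseudo_inner_linear dest!: bspec)
    with wn show "(\<forall>t\<in>?T. \<llangle>n, t\<rrangle> = 0) \<and> w - n \<in> ?T"
      by blast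
  next
    fix n' assume n': "(\<forall>t\<in>tangent_plane z u v. \<llangle>n', t\<rrangle> = 0) \<and> w - n' \<in> tangent_plane z u v"
    have T: "D1 z u v \<in> tangent_plane z u v" "D2 z u v \<in> tangent_plane z u v"
      by (auto simp: tangent_plane_def span_base)
    from wn have "(w - n) - (w - n') \<in> tangent_plane z u v"
      using n' unfolding tangent_plane_def by (blast intro: span_diff)
    then have "n' - n \<in> tangent_plane z u v"
      by simp
    then obtain r s where rs: "n' - n = r *\<^sub>R D1 z u v + s *\<^sub>R D2 z u v"
      by (auto simp: tangent_plane_def span_insert span_singleton algebra_simps eq_diff_eq)
    \<comment> \<open>A tangent vector orthogonal to both coordinate vectors vanishes, because \<open>E\<close> and \<open>G\<close> do not.\<close>
    have "\<llangle>n' - n, D1 z u v\<rrangle> = 0" "\<llangle>n' - n, D2 z u v\<rrangle> = 0"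
      using n n' T by (auto simp: pseudo_inner_diff_left)
    then have "r = 0" "s = 0"
      using F E G unfolding rs
      by (auto simp: pseudo_inner_linear fff_E_def fff_F_def fff_G_def pseudo_inner_commute[of "D2 z u v" "D1 z u v"])
    then show "n' = n"
      using rs by simp
  qed
qed

text \<open>A vector without normal part equals its orthogonal projection to the tangent plane.  This turns
  parallelism into scalar equations, one for each normal vector \<open>n\<close>.\<close>

lemma normal_part_eq_0D:
  assumes F: "fff_F z u v = 0" and E: "fff_E z u v \<noteq> 0" and G: "fff_G z u v \<noteq> 0"
    and w: "normal_part z u v w = 0"
    and n: "\<llangle>n, D1 z u v\<rrangle> = 0" "\<llangle>n, D2 z u v\<rrangle> = 0"
  shows "\<llangle>w, n\<rrangle> = 0"
proof -
  let ?p = "\<llangle>w, D1 z u v\<rrangle> / fff_E z u v" and ?q = "\<llangle>w, D2 z u v\<rrangle> / fff_G z u v"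
  let ?n = "w - ?p *\<^sub>R D1 z u v - ?q *\<^sub>R D2 z u v"
  have "normal_part z u v w = ?n"
    by (rule normal_part_eqI[where p = ?p and q = ?q])
      (use F E G in \<open>auto simp: pseudo_inner_linear fff_E_def fff_F_def fff_G_def
         pseudo_inner_commute[of "D2 z u v" "D1 z u v"]\<close>)
  then have "w = ?p *\<^sub>R D1 z u v + ?q *\<^sub>R D2 z u v"
    using w by (simp add: algebra_simps)
  then have "\<llangle>w, n\<rrangle> = ?p * \<llangle>D1 z u v, n\<rrangle> + ?q * \<llangle>D2 z u v, n\<rrangle>"
    by (metis pseudo_inner_add_left pseudo_inner_scaleR_left)
  then show ?thesis
    using n by (simp add: pseudo_inner_commute)
qed

section \<open>The mean curvature of a meridian surface\<close>

text \<open>The assumptions on the derivatives are what remains of the Lorentz condition in the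
  computations: they make \<open>E\<close> and \<open>G\<close> nonzero, so that normal parts exist.\<close>

locale meridian =
  fixes e :: "4 \<Rightarrow> real^4" and I J :: "real set" and f g \<phi> :: "real \<Rightarrow> real"
  assumes basis: "pseudo_orthonormal_basis e"
    and open_I: "open I" and open_J: "open J"
    and convex_I: "convex I" and convex_J: "convex J"
    and smooth: "smooth_on I f" "smooth_on I g" "smooth_on J \<phi>"
    and f_pos: "u \<in> I \<Longrightarrow> f u > 0"
    and deriv_f_nz: "u \<in> I \<Longrightarrow> deriv f u \<noteq> 0" and deriv_g_nz: "u \<in> I \<Longrightarrow> deriv g u \<noteq> 0"
    and curve_nonnull: "v \<in> J \<Longrightarrow> (deriv \<phi> v)\<^sup>2 - (\<phi> v)\<^sup>2 \<noteq> 0"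
begin

abbreviation "z \<equiv> meridian_surface e f g \<phi>"
abbreviation "fr \<equiv> frame_vector e"

text \<open>The square \<open>\<langle>l', l'\<rangle>\<close>, which may be negative.\<close>

definition "speed_sq v = (deriv \<phi> v)\<^sup>2 - (\<phi> v)\<^sup>2"

text \<open>This is \<open>\<langle>l'', n\<^sub>2\<rangle>\<close>: the determinant of acceleration and velocity of the plane curve
  \<open>v \<mapsto> \<phi> cosh v e\<^sub>1 + \<phi> sinh v e\<^sub>3\<close>.  It vanishes identically exactly when that curve is straight.\<close>

definition "\<kappa> v = \<phi> v * deriv (deriv \<phi>) v + (\<phi> v)\<^sup>2 - 2 * (deriv \<phi> v)\<^sup>2"

text \<open>Both \<open>l\<close> and \<open>\<xi>\<^sub>1\<close> are lightlike, so \<open>f' l - g' \<xi>\<^sub>1\<close> is orthogonal to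
  \<open>z\<^sub>u = f' l + g' \<xi>\<^sub>1\<close>.\<close>

definition "n\<^sub>1 u v = fr (deriv f u * (\<phi> v * cosh v)) (deriv f u * (\<phi> v * sinh v))
    (deriv f u * ((\<phi> v)\<^sup>2 / 2) - deriv g u) (deriv f u)"

definition "deriv_n\<^sub>1 u v = fr (deriv (deriv f) u * (\<phi> v * cosh v)) (deriv (deriv f) u * (\<phi> v * sinh v))
        (deriv (deriv f) u * ((\<phi> v)\<^sup>2 / 2) - deriv (deriv g) u) (deriv (deriv f) u)"

text \<open>The projection of \<open>l'\<close> to the plane of \<open>e\<^sub>1\<close> and \<open>e\<^sub>3\<close> has coordinates
  \<open>\<phi>' cosh v + \<phi> sinh v\<close> and \<open>\<phi>' sinh v + \<phi> cosh v\<close>.  Exchanging the two coordinates gives an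
  orthogonal vector of this Lorentz plane, and the multiple \<open>\<phi>\<^sup>2\<close> of \<open>\<xi>\<^sub>1\<close> makes the result orthogonal
  to \<open>l\<close> as well.\<close>

definition "n\<^sub>2 v = fr (deriv \<phi> v * sinh v + \<phi> v * cosh v) (deriv \<phi> v * cosh v + \<phi> v * sinh v)
    ((\<phi> v)\<^sup>2) 0"

text \<open>The coefficients of the mean curvature vector field with respect to \<open>n\<^sub>1\<close> and \<open>n\<^sub>2\<close>.\<close>

definition "\<alpha> u = - (1/2) * ((deriv (deriv f) u * deriv g u - deriv f u * deriv (deriv g) u)
      / (4 * (deriv f u)\<^sup>2 * (deriv g u)\<^sup>2) + 1 / (2 * f u * deriv g u))"

definition "\<beta> u v = - \<kappa> v / (2 * (speed_sq v)\<^sup>2 * f u)"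

lemma z_eq: "z u v = fr (f u * (\<phi> v * cosh v)) (f u * (\<phi> v * sinh v)) (f u * ((\<phi> v)\<^sup>2 / 2) + g u) (f u)"
  by (simp add: meridian_surface_def frame_vector_def algebra_simps)

lemmas derivs_f = smooth_on_has_derivs[OF smooth(1)]
lemmas derivs_g = smooth_on_has_derivs[OF smooth(2)]
lemmas derivs_\<phi> = smooth_on_has_derivs[OF smooth(3)]
lemmas inner_fr = pseudo_inner_frame_vector[OF basis]

lemma D1_z:
  assumes "u \<in> I"
  shows "D1 z u v = fr (deriv f u * (\<phi> v * cosh v)) (deriv f u * (\<phi> v * sinh v))
    (deriv f u * ((\<phi> v)\<^sup>2 / 2) + deriv g u) (deriv f u)"
  by (rule D1_eqI[OF open_I assms z_eq], rule frame_vector_has_vector_derivative)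
    (rule derivative_eq_intros derivs_f[OF assms] derivs_g[OF assms] refl | simp)+

lemma D2_z:
  assumes "v \<in> J"
  shows "D2 z u v = fr (f u * (deriv \<phi> v * cosh v + \<phi> v * sinh v))
    (f u * (deriv \<phi> v * sinh v + \<phi> v * cosh v)) (f u * (\<phi> v * deriv \<phi> v)) 0"
  by (rule D2_eqI[OF open_J assms z_eq], rule frame_vector_has_vector_derivative)
    (rule derivative_eq_intros derivs_\<phi>[OF assms] refl | simp)+

lemma D1_D1_z:
  assumes "u \<in> I"
  shows "D1 (D1 z) u v = fr (deriv (deriv f) u * (\<phi> v * cosh v)) (deriv (deriv f) u * (\<phi> v * sinh v))
    (deriv (deriv f) u * ((\<phi> v)\<^sup>2 / 2) + deriv (deriv g) u) (deriv (deriv f) u)"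
  by (rule D1_eqI[OF open_I assms D1_z], assumption, rule frame_vector_has_vector_derivative)
    (rule derivative_eq_intros derivs_f[OF assms] derivs_g[OF assms] refl | simp)+

lemma D2_D2_z:
  assumes "v \<in> J"
  shows "D2 (D2 z) u v =
    fr (f u * ((deriv (deriv \<phi>) v + \<phi> v) * cosh v + 2 * deriv \<phi> v * sinh v))
      (f u * ((deriv (deriv \<phi>) v + \<phi> v) * sinh v + 2 * deriv \<phi> v * cosh v))
      (f u * ((deriv \<phi> v)\<^sup>2 + \<phi> v * deriv (deriv \<phi>) v)) 0"
  by (rule D2_eqI[OF open_J assms D2_z], assumption, rule frame_vector_has_vector_derivative)
    (rule derivative_eq_intros derivs_\<phi>[OF assms] refl | simp add: algebra_simps power2_eq_square)+

lemma fff: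
  assumes "u \<in> I" "v \<in> J"
  shows "fff_E z u v = - 2 * deriv f u * deriv g u" "fff_F z u v = 0"
    "fff_G z u v = (f u)\<^sup>2 * speed_sq v"
  using cosh_square_eq[of v]
  unfolding fff_E_def fff_F_def fff_G_def D1_z[OF assms(1)] D2_z[OF assms(2)] inner_fr speed_sq_def
  by algebra+

lemma fff_nz:
  assumes "u \<in> I" "v \<in> J"
  shows "fff_F z u v = 0" "fff_E z u v \<noteq> 0" "fff_G z u v \<noteq> 0"
  using fff[OF assms] f_pos[of u] deriv_f_nz[of u] deriv_g_nz[of u] curve_nonnull[of v] assms
  by (auto simp: speed_sq_def)

lemma n\<^sub>1_normal:
  assumes "u \<in> I" "v \<in> J"
  shows "\<llangle>n\<^sub>1 u v, D1 z u v\<rrangle> = 0" "\<llangle>n\<^sub>1 u v, D2 z u v\<rrangle> = 0"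
  using cosh_square_eq[of v]
  unfolding n\<^sub>1_def D1_z[OF assms(1)] D2_z[OF assms(2)] inner_fr
  by algebra+

lemma n\<^sub>2_normal:
  assumes "u \<in> I" "v \<in> J"
  shows "\<llangle>n\<^sub>2 v, D1 z u v\<rrangle> = 0" "\<llangle>n\<^sub>2 v, D2 z u v\<rrangle> = 0"
proof -
  show "\<llangle>n\<^sub>2 v, D1 z u v\<rrangle> = 0"
    using cosh_square_eq[of v] unfolding n\<^sub>2_def D1_z[OF assms(1)] inner_fr by algebra
  show "\<llangle>n\<^sub>2 v, D2 z u v\<rrangle> = 0"
    unfolding n\<^sub>2_def D2_z[OF assms(2)] inner_fr by (simp add: algebra_simps)
qed

lemma inner_n\<^sub>1_n\<^sub>1: "\<llangle>n\<^sub>1 u v, n\<^sub>1 u v\<rrangle> = 2 * deriv f u * deriv g u"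
  and inner_n\<^sub>1_n\<^sub>2: "\<llangle>n\<^sub>1 u v, n\<^sub>2 v\<rrangle> = 0"
  and inner_n\<^sub>2_n\<^sub>2: "\<llangle>n\<^sub>2 v, n\<^sub>2 v\<rrangle> = - speed_sq v"
  using cosh_square_eq[of v] unfolding n\<^sub>1_def n\<^sub>2_def speed_sq_def inner_fr by algebra+

text \<open>The vector \<open>z\<^sub>u\<^sub>u = f'' l + g'' \<xi>\<^sub>1\<close> lies in the span of \<open>l\<close> and \<open>\<xi>\<^sub>1\<close>, which is also spanned by
  \<open>z\<^sub>u\<close> and \<open>n\<^sub>1\<close>.\<close>

lemma h11_z:
  assumes "u \<in> I" "v \<in> J"
  shows "h11 z u v = ((deriv (deriv f) u * deriv g u - deriv f u * deriv (deriv g) u)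
      / (2 * deriv f u * deriv g u)) *\<^sub>R n\<^sub>1 u v"
proof -
  define q where "q = (deriv (deriv f) u * deriv g u - deriv f u * deriv (deriv g) u)
      / (2 * deriv f u * deriv g u)"
  define p where "p = (deriv (deriv f) u * deriv g u + deriv f u * deriv (deriv g) u)
      / (2 * deriv f u * deriv g u)"
  have pq: "q * deriv f u + p * deriv f u = deriv (deriv f) u"
      "p * deriv g u - q * deriv g u = deriv (deriv g) u"
    unfolding p_def q_def
    using deriv_f_nz[OF assms(1)] deriv_g_nz[OF assms(1)] by (simp_all add: field_simps)
  have c: "q * (deriv f u * x) + p * (deriv f u * x) = deriv (deriv f) u * x"
    "q * (deriv f u * x - deriv g u) + p * (deriv f u * x + deriv g u)
      = deriv (deriv f) u * x + deriv (deriv g) u" for x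
    unfolding pq[symmetric] by (simp_all add: algebra_simps)
  have "normal_part z u v (D1 (D1 z) u v) = q *\<^sub>R n\<^sub>1 u v"
  proof (rule normal_part_eqI[OF fff_nz[OF assms]])
    show "\<llangle>q *\<^sub>R n\<^sub>1 u v, D1 z u v\<rrangle> = 0" "\<llangle>q *\<^sub>R n\<^sub>1 u v, D2 z u v\<rrangle> = 0"
      using n\<^sub>1_normal[OF assms] by (simp_all add: pseudo_inner_linear)
    show "D1 (D1 z) u v = q *\<^sub>R n\<^sub>1 u v + p *\<^sub>R D1 z u v + 0 *\<^sub>R D2 z u v"
      unfolding n\<^sub>1_def D1_z[OF assms(1)] D1_D1_z[OF assms(1)]
      by (simp only: frame_vector_add frame_vector_scaleR c pq(1) scaleR_zero_left add_0_right)
  qed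
  then show ?thesis
    unfolding h11_def q_def .
qed

text \<open>Since \<open>l''\<close> is orthogonal to \<open>\<xi>\<^sub>1\<close>, it is a combination of \<open>l'\<close>, \<open>n\<^sub>2\<close> and \<open>\<xi>\<^sub>1\<close>.  The first is
  tangent, the second gives the term with \<open>\<kappa>\<close>, and the third contributes to \<open>n\<^sub>1\<close>.\<close>

lemma h22_z:
  assumes "u \<in> I" "v \<in> J"
  shows "h22 z u v = (- f u * speed_sq v / (2 * deriv g u)) *\<^sub>R n\<^sub>1 u v + (- f u * \<kappa> v / speed_sq v) *\<^sub>R n\<^sub>2 v"
    (is "_ = ?n")
  unfolding h22_def
proof (rule normal_part_eqI[OF fff_nz[OF assms]])
  show "\<llangle>?n, D1 z u v\<rrangle> = 0" "\<llangle>?n, D2 z u v\<rrangle> = 0"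
    using n\<^sub>1_normal[OF assms] n\<^sub>2_normal[OF assms] by (simp_all add: pseudo_inner_linear)
  define p where "p = f u * speed_sq v / (2 * deriv g u)"
  define q where "q = deriv \<phi> v * (deriv (deriv \<phi>) v - \<phi> v) / speed_sq v"
  define r where "r = \<kappa> v / speed_sq v"
  have nz: "speed_sq v \<noteq> 0" "deriv g u \<noteq> 0"
    using curve_nonnull[OF assms(2)] deriv_g_nz[OF assms(1)] by (auto simp: speed_sq_def)
  have pg: "p * deriv g u * 2 = f u * speed_sq v"
    using nz by (simp add: p_def)
  have qr: "q * speed_sq v = deriv \<phi> v * (deriv (deriv \<phi>) v - \<phi> v)" "r * speed_sq v = \<kappa> v"
    using nz by (simp_all add: q_def r_def)
  \<comment> \<open>The next two identities say that \<open>l'' = q l' - r n\<^sub>2\<close> modulo \<open>\<xi>\<^sub>1\<close>.  The missing multiple of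
    \<open>\<xi>\<^sub>1\<close> is \<open>speed_sq v\<close>, and \<open>\<xi>\<^sub>1 = (z\<^sub>u - n\<^sub>1) / (2 g')\<close> splits it, which explains \<open>p\<close>.\<close>
  have q1: "q * deriv \<phi> v - r * \<phi> v = deriv (deriv \<phi>) v + \<phi> v"
  proof -
    have "(q * deriv \<phi> v - r * \<phi> v) * speed_sq v = (deriv (deriv \<phi>) v + \<phi> v) * speed_sq v"
      using qr unfolding speed_sq_def \<kappa>_def by algebra
    then show ?thesis using nz by simp
  qed
  have q2: "q * \<phi> v - r * deriv \<phi> v = 2 * deriv \<phi> v"
  proof -
    have "(q * \<phi> v - r * deriv \<phi> v) * speed_sq v = 2 * deriv \<phi> v * speed_sq v"
      using qr unfolding speed_sq_def \<kappa>_def by algebra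
    then show ?thesis using nz by simp
  qed
  have n: "?n = (- p) *\<^sub>R n\<^sub>1 u v + (- f u * r) *\<^sub>R n\<^sub>2 v"
    by (simp add: p_def r_def)
  have c1: "f u * ((deriv (deriv \<phi>) v + \<phi> v) * cosh v + 2 * deriv \<phi> v * sinh v)
     = - p * (deriv f u * (\<phi> v * cosh v)) + - f u * r * (deriv \<phi> v * sinh v + \<phi> v * cosh v)
       + p * (deriv f u * (\<phi> v * cosh v)) + q * (f u * (deriv \<phi> v * cosh v + \<phi> v * sinh v))"
    using q1 q2 by algebra
  have c2: "f u * ((deriv (deriv \<phi>) v + \<phi> v) * sinh v + 2 * deriv \<phi> v * cosh v)
     = - p * (deriv f u * (\<phi> v * sinh v)) + - f u * r * (deriv \<phi> v * cosh v + \<phi> v * sinh v)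
       + p * (deriv f u * (\<phi> v * sinh v)) + q * (f u * (deriv \<phi> v * sinh v + \<phi> v * cosh v))"
    using q1 q2 by algebra
  have q3: "q * (\<phi> v * deriv \<phi> v) - r * (\<phi> v)\<^sup>2 + speed_sq v = (deriv \<phi> v)\<^sup>2 + \<phi> v * deriv (deriv \<phi>) v"
    using q1 unfolding speed_sq_def by algebra
  have c3: "f u * ((deriv \<phi> v)\<^sup>2 + \<phi> v * deriv (deriv \<phi>) v)
     = - p * (deriv f u * ((\<phi> v)\<^sup>2 / 2) - deriv g u) + - f u * r * (\<phi> v)\<^sup>2
       + p * (deriv f u * ((\<phi> v)\<^sup>2 / 2) + deriv g u) + q * (f u * (\<phi> v * deriv \<phi> v))"
    using pg unfolding q3[symmetric] by (simp add: algebra_simps)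
  show "D2 (D2 z) u v = ?n + p *\<^sub>R D1 z u v + q *\<^sub>R D2 z u v"
    unfolding n
    unfolding n\<^sub>1_def n\<^sub>2_def D1_z[OF assms(1)] D2_z[OF assms(2)] D2_D2_z[OF assms(2)]
      frame_vector_add frame_vector_scaleR c1 c2 c3
    by simp
qed

text \<open>Because \<open>F\<close> vanishes, the mean curvature vector is half of \<open>h\<^sub>1\<^sub>1 / E + h\<^sub>2\<^sub>2 / G\<close>.  What matters
  below is how the coefficients depend on the parameters: \<open>\<alpha>\<close> on \<open>u\<close> alone, and \<open>\<beta>\<close> on \<open>u\<close>
  only through the factor \<open>1 / f\<close>.\<close>

lemma mean_curvature_z:
  assumes "u \<in> I" "v \<in> J"
  shows "mean_curvature z u v = \<alpha> u *\<^sub>R n\<^sub>1 u v + \<beta> u v *\<^sub>R n\<^sub>2 v"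
proof -
  have nz: "f u \<noteq> 0" "deriv f u \<noteq> 0" "deriv g u \<noteq> 0" "speed_sq v \<noteq> 0"
    using f_pos deriv_f_nz deriv_g_nz curve_nonnull assms by (force simp: speed_sq_def)+
  let ?E = "- 2 * deriv f u * deriv g u" and ?G = "(f u)\<^sup>2 * speed_sq v"
  let ?q = "(deriv (deriv f) u * deriv g u - deriv f u * deriv (deriv g) u)
      / (2 * deriv f u * deriv g u)"
  have "mean_curvature z u v = (1 / (2 * ?E * ?G)) *\<^sub>R
      (?G *\<^sub>R ?q *\<^sub>R n\<^sub>1 u v + ?E *\<^sub>R ((- f u * speed_sq v / (2 * deriv g u)) *\<^sub>R n\<^sub>1 u v
        + (- f u * \<kappa> v / speed_sq v) *\<^sub>R n\<^sub>2 v))"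
    unfolding mean_curvature_def fff[OF assms] h11_z[OF assms] h22_z[OF assms] by simp
  also have "\<dots> = (1 / (2 * ?E * ?G) * (?G * ?q + ?E * (- f u * speed_sq v / (2 * deriv g u)))) *\<^sub>R n\<^sub>1 u v
      + (1 / (2 * ?E * ?G) * (?E * (- f u * \<kappa> v / speed_sq v))) *\<^sub>R n\<^sub>2 v"
    by (simp only: scaleR_add_right scaleR_add_left scaleR_scaleR distrib_left add.assoc)
  also have "1 / (2 * ?E * ?G) * (?G * ?q + ?E * (- f u * speed_sq v / (2 * deriv g u))) = \<alpha> u"
    using nz unfolding \<alpha>_def by (simp add: divide_simps) algebra
  also have "1 / (2 * ?E * ?G) * (?E * (- f u * \<kappa> v / speed_sq v)) = \<beta> u v"
    using nz unfolding \<beta>_def by (simp add: divide_simps) algebra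
  finally show ?thesis .
qed

section \<open>Consequences of a parallel mean curvature vector field\<close>

lemma \<alpha>_differentiable:
  assumes "u \<in> I"
  shows "(\<alpha> has_real_derivative deriv \<alpha> u) (at u)"
proof -
  have "\<exists>D. (\<alpha> has_real_derivative D) (at u)"
    unfolding \<alpha>_def
    by (rule exI, (rule derivative_eq_intros derivs_f[OF assms] derivs_g[OF assms] refl
      | use f_pos[OF assms] deriv_f_nz[OF assms] deriv_g_nz[OF assms] in simp)+)
  then show ?thesis
    using DERIV_imp_deriv by blast
qed

lemma D1_mean_curvature_z:
  assumes "u \<in> I" "v \<in> J"
  shows "D1 (mean_curvature z) u v = deriv \<alpha> u *\<^sub>R n\<^sub>1 u v
    + \<alpha> u *\<^sub>R deriv_n\<^sub>1 u v
    + (\<kappa> v * deriv f u / (2 * (speed_sq v)\<^sup>2 * (f u)\<^sup>2)) *\<^sub>R n\<^sub>2 v"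
proof (rule D1_eqI[where y = "\<lambda>u. \<alpha> u *\<^sub>R n\<^sub>1 u v + \<beta> u v *\<^sub>R n\<^sub>2 v", OF open_I assms(1)])
  have n: "((\<lambda>u. n\<^sub>1 u v) has_vector_derivative deriv_n\<^sub>1 u v) (at u)"
    unfolding n\<^sub>1_def deriv_n\<^sub>1_def
    by (rule frame_vector_has_vector_derivative)
      (rule derivative_eq_intros derivs_f[OF assms(1)] derivs_g[OF assms(1)] refl | simp)+
  have nz: "f u \<noteq> 0" "speed_sq v \<noteq> 0"
    using f_pos[OF assms(1)] curve_nonnull[OF assms(2)] by (auto simp: speed_sq_def)
  have b: "((\<lambda>u. \<beta> u v) has_real_derivative \<kappa> v * deriv f u / (2 * (speed_sq v)\<^sup>2 * (f u)\<^sup>2)) (at u)"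
    unfolding \<beta>_def
    by (rule derivative_eq_intros derivs_f[OF assms(1)] refl | use nz in \<open>simp add: field_simps power2_eq_square\<close>)+
  show "mean_curvature z s v = \<alpha> s *\<^sub>R n\<^sub>1 s v + \<beta> s v *\<^sub>R n\<^sub>2 v" if "s \<in> I" for s
    by (rule mean_curvature_z[OF that assms(2)])
  show "((\<lambda>u. \<alpha> u *\<^sub>R n\<^sub>1 u v + \<beta> u v *\<^sub>R n\<^sub>2 v) has_vector_derivative
      deriv \<alpha> u *\<^sub>R n\<^sub>1 u v + \<alpha> u *\<^sub>R deriv_n\<^sub>1 u v + (\<kappa> v * deriv f u / (2 * (speed_sq v)\<^sup>2 * (f u)\<^sup>2)) *\<^sub>R n\<^sub>2 v) (at u)"
    by (rule derivative_eq_intros n b \<alpha>_differentiable[OF assms(1)] refl | simp)+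
qed

lemma parallel_D1_mean_curvature_orthogonal:
  assumes "parallel_on I J z (mean_curvature z)" "u \<in> I" "v \<in> J"
    and "\<llangle>n, D1 z u v\<rrangle> = 0" "\<llangle>n, D2 z u v\<rrangle> = 0"
  shows "\<llangle>D1 (mean_curvature z) u v, n\<rrangle> = 0"
proof -
  have "normal_connection z 1 0 (mean_curvature z) u v = 0"
    using assms unfolding parallel_on_def by blast
  then have "normal_part z u v (D1 (mean_curvature z) u v) = 0"
    by (simp add: normal_connection_def)
  then show ?thesis
    using normal_part_eq_0D[OF fff_nz] assms by blast
qed

text \<open>The field \<open>n\<^sub>2\<close> does not depend on \<open>u\<close>, and the derivative of \<open>n\<^sub>1\<close> with respect to \<open>u\<close> is
  orthogonal to it.  Hence the \<open>n\<^sub>2\<close>-component of \<open>D\<^sub>uH\<close> is \<open>\<beta>\<^sub>u\<close>, and this is \<open>\<kappa> f' / f\<^sup>2\<close> up to a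
  factor that is never zero.\<close>

lemma parallel_imp_\<kappa>_eq_0:
  assumes "parallel_on I J z (mean_curvature z)" "u \<in> I" "v \<in> J"
  shows "\<kappa> v = 0"
proof -
  have "\<llangle>deriv_n\<^sub>1 u v, n\<^sub>2 v\<rrangle> = 0"
    using cosh_square_eq[of v] unfolding deriv_n\<^sub>1_def n\<^sub>2_def inner_fr by algebra
  then have "\<kappa> v * deriv f u / (2 * (speed_sq v)\<^sup>2 * (f u)\<^sup>2) * - speed_sq v = 0"
    using parallel_D1_mean_curvature_orthogonal[OF assms n\<^sub>2_normal[OF assms(2,3)]]
    by (simp add: D1_mean_curvature_z[OF assms(2,3)] pseudo_inner_linear inner_n\<^sub>1_n\<^sub>2 inner_n\<^sub>2_n\<^sub>2)
  then show ?thesis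
    using f_pos[OF assms(2)] deriv_f_nz[OF assms(2)] curve_nonnull[OF assms(3)] by (simp add: speed_sq_def)
qed

text \<open>This is the \<open>n\<^sub>1\<close>-component of \<open>D\<^sub>uH = 0\<close>.  Up to the factor \<open>2 \<alpha>\<close>, the left side is the derivative
  of \<open>2 \<alpha>\<^sup>2 f' g'\<close>.\<close>

lemma parallel_imp_\<alpha>_ode:
  assumes "parallel_on I J z (mean_curvature z)" "u \<in> I" "v \<in> J"
  shows "2 * deriv \<alpha> u * deriv f u * deriv g u
    + \<alpha> u * (deriv (deriv f) u * deriv g u + deriv f u * deriv (deriv g) u) = 0"
proof -
  have "\<llangle>deriv_n\<^sub>1 u v, n\<^sub>1 u v\<rrangle>
      = deriv (deriv f) u * deriv g u + deriv f u * deriv (deriv g) u"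
    using cosh_square_eq[of v] unfolding deriv_n\<^sub>1_def n\<^sub>1_def inner_fr by algebra
  then show ?thesis
    using parallel_D1_mean_curvature_orthogonal[OF assms n\<^sub>1_normal[OF assms(2,3)]]
    by (simp add: D1_mean_curvature_z[OF assms(2,3)] pseudo_inner_linear inner_n\<^sub>1_n\<^sub>1
        pseudo_inner_commute[of "n\<^sub>2 v"] inner_n\<^sub>1_n\<^sub>2)
qed

text \<open>With \<open>\<kappa> = 0\<close> only \<open>H = \<alpha> n\<^sub>1\<close> remains, so \<open>\<langle>H, H\<rangle> = 2 \<alpha>\<^sup>2 f' g'\<close> does not depend on \<open>v\<close>, and
  the equation for \<open>\<alpha>\<close> makes it constant in \<open>u\<close>.\<close>

lemma parallel_imp_CMC:
  assumes par: "parallel_on I J z (mean_curvature z)"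
    and nz: "\<And>u v. u \<in> I \<Longrightarrow> v \<in> J \<Longrightarrow> mean_curvature z u v \<noteq> 0"
    and ne: "I \<noteq> {}" "J \<noteq> {}"
  shows "CMC_surface I J z"
proof -
  obtain v\<^sub>0 where v\<^sub>0: "v\<^sub>0 \<in> J" using ne by blast
  have H: "mean_curvature z u v = \<alpha> u *\<^sub>R n\<^sub>1 u v" if "u \<in> I" "v \<in> J" for u v
    using mean_curvature_z[OF that] parallel_imp_\<kappa>_eq_0[OF par that] by (simp add: \<beta>_def)
  have "\<exists>c. \<forall>u\<in>I. (\<alpha> u)\<^sup>2 * (2 * deriv f u * deriv g u) = c"
  proof (rule has_field_derivative_zero_constant[OF convex_I])
    fix u assume u: "u \<in> I"
    have "((\<lambda>u. (\<alpha> u)\<^sup>2 * (2 * deriv f u * deriv g u)) has_real_derivative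
        2 * \<alpha> u * (2 * deriv \<alpha> u * deriv f u * deriv g u
          + \<alpha> u * (deriv (deriv f) u * deriv g u + deriv f u * deriv (deriv g) u))) (at u)"
      by (rule derivative_eq_intros \<alpha>_differentiable[OF u] derivs_f[OF u] derivs_g[OF u] refl
        | simp add: algebra_simps power2_eq_square)+
    then show "((\<lambda>u. (\<alpha> u)\<^sup>2 * (2 * deriv f u * deriv g u)) has_real_derivative 0) (at u within I)"
      using parallel_imp_\<alpha>_ode[OF par u v\<^sub>0] by (simp add: has_field_derivative_at_within)
  qed
  then obtain c where c: "\<And>u. u \<in> I \<Longrightarrow> (\<alpha> u)\<^sup>2 * (2 * deriv f u * deriv g u) = c" by blast
  have "\<llangle>mean_curvature z u v, mean_curvature z u v\<rrangle> = c" if "u \<in> I" "v \<in> J" for u v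
    using c[OF that(1)] unfolding H[OF that]
    by (simp add: pseudo_inner_linear inner_n\<^sub>1_n\<^sub>1 power2_eq_square mult.assoc)
  moreover have "c \<noteq> 0"
  proof -
    obtain u where u: "u \<in> I" using ne by blast
    have "\<alpha> u \<noteq> 0" using nz[OF u v\<^sub>0] H[OF u v\<^sub>0] by auto
    then show ?thesis using c[OF u] deriv_f_nz[OF u] deriv_g_nz[OF u] by auto
  qed
  ultimately show ?thesis
    unfolding CMC_surface_def by blast
qed

text \<open>The surface is orthogonal to \<open>n\<^sub>2\<close>, being spanned by \<open>l\<close> and \<open>\<xi>\<^sub>1\<close>.  When \<open>\<kappa> = 0\<close> the direction
  of \<open>n\<^sub>2\<close> is constant, and \<open>n\<^sub>2 / \<phi>\<^sup>2\<close> is a constant vector of this direction.\<close>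

lemma \<kappa>_eq_0_imp_hyperplane:
  assumes \<kappa>: "\<And>v. v \<in> J \<Longrightarrow> \<kappa> v = 0"
  shows "\<exists>P. hyperplane P \<and> (\<forall>u. \<forall>v\<in>J. z u v \<in> P)"
proof -
  \<comment> \<open>At a zero of \<open>\<phi>\<close>, the equation \<open>\<kappa> = 0\<close> forces \<open>\<phi>' = 0\<close> and hence \<open>l'\<close> to be null.\<close>
  have \<phi>_nz: "\<phi> v \<noteq> 0" if "v \<in> J" for v
    using \<kappa>[OF that] curve_nonnull[OF that] by (auto simp: \<kappa>_def)
  have ode: "\<phi> v * deriv (deriv \<phi>) v = 2 * (deriv \<phi> v)\<^sup>2 - (\<phi> v)\<^sup>2" if "v \<in> J" for v
    using \<kappa>[OF that] by (simp add: \<kappa>_def)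
  \<comment> \<open>The equation \<open>\<kappa> = 0\<close> says that \<open>y = 1 / \<phi>\<close> satisfies \<open>y'' = y\<close>.  The quotient below is the
    Wronskian \<open>y q - y' p\<close> of \<open>y\<close> with another solution \<open>p\<close> of the same equation.\<close>
  have wronskian: "\<exists>c. \<forall>v\<in>J. (deriv \<phi> v * p v + \<phi> v * q v) / (\<phi> v)\<^sup>2 = c"
    if pq: "\<And>v. (p has_real_derivative q v) (at v)" "\<And>v. (q has_real_derivative p v) (at v)" for p q
  proof (rule has_field_derivative_zero_constant[OF convex_J])
    fix v assume v: "v \<in> J"
    have "((\<lambda>v. (deriv \<phi> v * p v + \<phi> v * q v) / (\<phi> v)\<^sup>2) has_real_derivative
       ((deriv (deriv \<phi>) v * p v + deriv \<phi> v * q v + (deriv \<phi> v * q v + \<phi> v * p v)) * (\<phi> v)\<^sup>2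
         - (deriv \<phi> v * p v + \<phi> v * q v) * (2 * \<phi> v * deriv \<phi> v)) / ((\<phi> v)\<^sup>2 * (\<phi> v)\<^sup>2)) (at v)"
      by (rule derivative_eq_intros derivs_\<phi>[OF v] pq refl
        | use \<phi>_nz[OF v] in \<open>simp add: algebra_simps\<close>)+
    moreover have "(deriv (deriv \<phi>) v * p v + deriv \<phi> v * q v + (deriv \<phi> v * q v + \<phi> v * p v)) * (\<phi> v)\<^sup>2
         - (deriv \<phi> v * p v + \<phi> v * q v) * (2 * \<phi> v * deriv \<phi> v) = 0"
      using ode[OF v] by algebra
    ultimately show "((\<lambda>v. (deriv \<phi> v * p v + \<phi> v * q v) / (\<phi> v)\<^sup>2) has_real_derivative 0) (at v within J)"
      by (simp add: has_field_derivative_at_within)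
  qed
  obtain b where b: "\<And>v. v \<in> J \<Longrightarrow> (deriv \<phi> v * sinh v + \<phi> v * cosh v) / (\<phi> v)\<^sup>2 = b"
    using wronskian[of sinh cosh] by (blast intro: has_field_derivative_sinh[OF DERIV_ident, simplified]
        has_field_derivative_cosh[OF DERIV_ident, simplified])
  obtain d where d: "\<And>v. v \<in> J \<Longrightarrow> (deriv \<phi> v * cosh v + \<phi> v * sinh v) / (\<phi> v)\<^sup>2 = d"
    using wronskian[of cosh sinh] by (blast intro: has_field_derivative_cosh[OF DERIV_ident, simplified]
        has_field_derivative_sinh[OF DERIV_ident, simplified])
  let ?n = "fr b d 1 0"
  have n: "?n = (1 / (\<phi> v)\<^sup>2) *\<^sub>R n\<^sub>2 v" if "v \<in> J" for v
    using \<phi>_nz[OF that] by (simp add: n\<^sub>2_def frame_vector_scaleR b[OF that, symmetric] d[OF that, symmetric])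
  have "\<llangle>z u v, n\<^sub>2 v\<rrangle> = 0" for u v
    using cosh_square_eq[of v] unfolding z_eq n\<^sub>2_def inner_fr by algebra
  then have "z u v \<in> {x. \<llangle>x, ?n\<rrangle> = 0}" if "v \<in> J" for u v
    by (simp add: n[OF that] pseudo_inner_linear)
  moreover have "hyperplane {x. \<llangle>x, ?n\<rrangle> = 0}"
    by (rule hyperplane_pseudo_orthogonal[where w = "fr 0 0 0 1"]) (simp add: inner_fr)
  ultimately show ?thesis by blast
qed

end

theorem corollary5:
  fixes e :: "4 \<Rightarrow> real^4"
    and I J :: "real set"
    and f g \<phi> :: "real \<Rightarrow> real"
    and z :: "real \<Rightarrow> real \<Rightarrow> real^4"
  assumes "pseudo_orthonormal_basis e"
    and "open I" "is_interval I" "I \<noteq> {}"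
    and "open J" "is_interval J" "J \<noteq> {}"
    and "smooth_on I f" "smooth_on I g" "smooth_on J \<phi>"
    and "\<forall>u\<in>I. f u > 0"
    and lorentz:
      "((\<forall>v\<in>J. (deriv \<phi> v)\<^sup>2 - (\<phi> v)\<^sup>2 > 0) \<and> (\<forall>u\<in>I. deriv f u * deriv g u > 0)) \<or>
       ((\<forall>v\<in>J. (deriv \<phi> v)\<^sup>2 - (\<phi> v)\<^sup>2 < 0) \<and> (\<forall>u\<in>I. deriv f u * deriv g u < 0))"
    and z_def: "z = meridian_surface e f g \<phi>"
    and "\<forall>u\<in>I. \<forall>v\<in>J. mean_curvature z u v \<noteq> 0"
    and "parallel_on I J z (mean_curvature z)"
  shows "CMC_surface I J z \<and>
    (\<exists>P. hyperplane P \<and> (\<forall>u\<in>I. \<forall>v\<in>J. z u v \<in> P))"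
proof -
  interpret meridian e I J f g \<phi>
    using assms(1-11) lorentz by unfold_locales (auto simp: is_interval_convex)
  obtain u\<^sub>0 where u\<^sub>0: "u\<^sub>0 \<in> I" using assms by blast
  have par: "parallel_on I J (meridian_surface e f g \<phi>) (mean_curvature (meridian_surface e f g \<phi>))"
    using assms by blast
  show ?thesis
    using parallel_imp_CMC[OF par] \<kappa>_eq_0_imp_hyperplane[OF parallel_imp_\<kappa>_eq_0[OF par u\<^sub>0]] assms
    by blast
qed

end
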